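(* Let $N\ge1$, let $(\eta_t)_{t\ge0}$ be median dynamics on the complete graph $K_N$, and let $x$ be a vertex of $K_N$. Then: (i) For every $\alpha\in[0,\tfrac12]$, the function $t\mapsto \mathbb P[\eta_t(x)\in[0,\alpha)]$ is monotone non-increasing on $[0,\infty)$. (ii) For every $t\ge0$, the distribution of $\eta_t(x)$ has a density $p_t$ with respect to Lebesgue measure on $[0,1]$ that is symmetric around $\tfrac12$ (that is, $p_t(u)=p_t(1-u)$) and monotone non-decreasing on $[0,\tfrac12]$.
   Context: For a vertex $x$ of a graph, $N(x)$ is the set of neighbors of $x$, with the convention that $x$ itself is added to $N(x)$ if its degree is even, so that $|N(x)|$ is always odd. Median dynamics $(\eta_t)_{t\ge0}$ on a graph with vertex set $V$ has state space $[0,1]^{V}$. The initial values $(\eta_0(x))_{x\in V}$ are i.i.d. uniform on $[0,1]$. Independently, each vertex has an independent rate-one Poisson clock. At each ring $s$ of the clock of $x$, the value at $x$ is replaced by the median of $\{\eta_{s-}(z): z\in N(x)\}$ (counted with multiplicity), and no other value changes. *)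

theory Defs
  imports "HOL-Probability.Probability" "Graph_Theory.Graph_Theory"
begin

definition median_nbhd :: "('v, 'e) pre_digraph \<Rightarrow> 'v \<Rightarrow> 'v set" where
  "median_nbhd G x =
     (let A = {y. x \<rightarrow>\<^bsub>G\<^esub> y} in if even (out_degree G x) then insert x A else A)"

text \<open>
  The median of the family \<open>f\<close> over a finite set of odd cardinality \<open>2 k + 1\<close>: values are
  counted with multiplicity, and the entry with (zero-based) index \<open>k\<close> of their sorted list
  is selected.
\<close>

definition median_on :: "'v set \<Rightarrow> ('v \<Rightarrow> real) \<Rightarrow> real" where
  "median_on A f = sorted_list_of_multiset (image_mset f (mset_set A)) ! (card A div 2)"

text \<open>
  A Poisson clock is given by its waiting times \<open>W\<close>: the first ring is at time \<open>W 0\<close>, and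
  \<open>W (n + 1)\<close> is the time between rings \<open>n\<close> and \<open>n + 1\<close>.
\<close>

definition rings :: "(nat \<Rightarrow> real) \<Rightarrow> real set" where
  "rings W = {\<Sum>k\<le>n. W k | n. True}"

text \<open>
  \<open>\<eta> t x\<close> is the value at vertex \<open>x\<close> and time \<open>t \<ge> 0\<close>, and \<open>W x n\<close> is the \<open>n\<close>-th waiting time
  of the clock of \<open>x\<close>; negative times are irrelevant. The independence assumption comprises
  independence of the initial values among themselves, of the clocks among themselves, of the
  waiting times of each clock, and of the initial values from the clocks.
  The path assumptions are imposed almost surely; almost surely, rings do not accumulate
  and the left limits below exist.
\<close>

locale median_dynamics = prob_space M + graph G
  for M :: "'w measure" and G :: "('v, 'e) pre_digraph" +
  fixes \<eta> :: "real \<Rightarrow> 'v \<Rightarrow> 'w \<Rightarrow> real"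
    and W :: "'v \<Rightarrow> nat \<Rightarrow> 'w \<Rightarrow> real"
  assumes state:
      "\<And>t x. 0 \<le> t \<Longrightarrow> x \<in> verts G \<Longrightarrow> \<eta> t x \<in> measurable M (restrict_space borel {0..1})"
    and initial_uniform:
      "\<And>x. x \<in> verts G \<Longrightarrow> distr M lborel (\<eta> 0 x) = uniform_measure lborel {0..1}"
    and waiting_exponential:
      "\<And>x n. x \<in> verts G \<Longrightarrow> distributed M lborel (W x n) (exponential_density 1)"
    and independent:
      "indep_vars (\<lambda>_. borel) (case_sum (\<lambda>x. \<eta> 0 x) (\<lambda>(x, n). W x n))
         (verts G <+> verts G \<times> (UNIV :: nat set))"
    and update:
      "AE \<omega> in M. \<forall>x\<in>verts G. \<forall>s\<in>rings (\<lambda>n. W x n \<omega>).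
         \<eta> s x \<omega> = median_on (median_nbhd G x) (\<lambda>z. Lim (at_left s) (\<lambda>r. \<eta> r z \<omega>))"
    and no_update:
      "AE \<omega> in M. \<forall>x\<in>verts G. \<forall>s t. 0 \<le> s \<longrightarrow> s \<le> t \<longrightarrow> {s<..t} \<inter> rings (\<lambda>n. W x n \<omega>) = {} \<longrightarrow>
         \<eta> t x \<omega> = \<eta> s x \<omega>"

end

theory Submission
  imports Defs
begin

text \<open>
  On the complete graph the dynamics can be solved path by path, because the
  neighbourhood medians all agree and stay constant after the first update.
  Let \<open>y\<close> be the vertex whose clock rings first and let \<open>v\<close> be the median of the
  initial values over \<open>N(y)\<close>. Once \<open>y\<close> has taken the value \<open>v\<close>, every vertex sees the median \<open>v\<close>
  (\<open>consensus_after_first_update\<close>), and replacing further values by \<open>v\<close> keeps it so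
  (\<open>consensus_preserved\<close>). Hence almost surely a vertex \<open>x\<close> keeps its initial value until its own
  first ring and has the value \<open>v\<close> from then on (\<open>path_of_first_ring\<close>).

  The index \<open>y\<close> depends on the clocks only, and the law of the median over \<open>N(y)\<close> is the same for
  all \<open>y\<close>: it is the median of \<open>2 k + 1\<close> independent uniform variables. So, although \<open>y\<close> is
  random and depends on the clock of \<open>x\<close>, the value \<open>v\<close> is independent of the clocks, and for
  \<open>a \<in> [0, 1]\<close>
  \<open>P(\<eta>\<^sub>t(x) \<le> a) = exp (-t) a + (1 - exp (-t)) h(a)\<close>, where \<open>h(a)\<close> is the probability that a
  binomial variable with parameters \<open>2 k + 1\<close> and \<open>a\<close> exceeds \<open>k\<close> (\<open>prob_le_complete\<close>).

  Both claims follow from this formula. Differentiating the binomial tail telescopes to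
  \<open>h'(a) = c (a (1 - a))^k\<close>, which is symmetric about \<open>1/2\<close> and non-decreasing on \<open>[0, 1/2]\<close>; so is
  the density \<open>exp (-t) + (1 - exp (-t)) h'\<close>. Moreover \<open>h\<close> is convex on \<open>[0, 1/2]\<close> and agrees with
  the identity at both end points, so \<open>h(a) \<le> a\<close> there, and moving weight from \<open>a\<close> to \<open>h(a)\<close> as
  \<open>t\<close> grows can only decrease the distribution function.
\<close>


section \<open>Medians of odd families\<close>

text \<open>
  In a sorted list the entries satisfying a downward closed predicate form a prefix, so an entry
  satisfies it exactly when its index is smaller than the length of that prefix.
\<close>

lemma sorted_nth_downward_iff:
  fixes xs :: "'a :: linorder list"
  assumes "sorted xs" "k < length xs" and "\<And>x y. x \<le> y \<Longrightarrow> P y \<Longrightarrow> P x"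
  shows "P (xs ! k) \<longleftrightarrow> k < length (filter P xs)"
  using assms(1,2)
proof (induction xs arbitrary: k)
  case (Cons x xs)
  show ?case
  proof (cases "P x")
    case True
    then show ?thesis using Cons by (cases k) auto
  next
    case False
    then have none: "\<not> P y" if "y \<in> set (x # xs)" for y
      using that Cons.prems(1) assms(3) by auto
    then have "filter P (x # xs) = []" by (simp add: filter_empty_conv)
    moreover have "\<not> P ((x # xs) ! k)"
      using none Cons.prems(2) nth_mem by blast
    ultimately show ?thesis by simp
  qed
qed simp

text \<open>
  This majority criterion compares a median with a threshold, through the predicates
  \<open>\<lambda>y. y \<le> a\<close> and \<open>\<lambda>y. y < a\<close>. It follows from the description of the sorted list as a prefix of
  entries that satisfy the predicate and a rest of entries that do not.
\<close>

lemma median_on_downward_iff: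
  assumes "finite A" "odd (card A)" and "\<And>x y. x \<le> y \<Longrightarrow> P y \<Longrightarrow> P x"
  shows "P (median_on A f) \<longleftrightarrow> card A div 2 < card {z \<in> A. P (f z)}"
proof -
  let ?M = "image_mset f (mset_set A)"
  have "card A div 2 < length (sorted_list_of_multiset ?M)"
    using assms(2) by (simp flip: size_mset) (auto elim: oddE)
  then have "P (median_on A f) \<longleftrightarrow>
      card A div 2 < length (filter P (sorted_list_of_multiset ?M))"
    unfolding median_on_def by (rule sorted_nth_downward_iff[OF sorted_sorted_list_of_multiset _ assms(3)])
  also have "length (filter P (sorted_list_of_multiset ?M)) = size (filter_mset P ?M)"
    by (metis mset_filter mset_sorted_list_of_multiset size_mset)
  also have "\<dots> = card {z \<in> A. P (f z)}"
    using assms(1) by (simp add: filter_mset_image_mset)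
  finally show ?thesis .
qed

lemma median_on_cong:
  assumes "\<And>z. z \<in> A \<Longrightarrow> f z = g z"
  shows "median_on A f = median_on A g"
proof (cases "finite A")
  case True
  then have "image_mset f (mset_set A) = image_mset g (mset_set A)"
    using assms by (intro image_mset_cong) auto
  then show ?thesis by (simp add: median_on_def)
qed (simp add: median_on_def)

text \<open>
  Moving an entry to the median can only enlarge the set of entries that are at most the median,
  and can only shrink the set of entries strictly below it; so neither majority changes sides.
\<close>

lemma median_on_fun_upd_median:
  assumes A: "finite A" "odd (card A)"
  shows "median_on A (f(x := median_on A f)) = median_on A f"
proof -
  let ?v = "median_on A f"
  let ?g = "f(x := ?v)"
  note iff = median_on_downward_iff[OF A]
  have "card {z \<in> A. f z \<le> ?v} \<le> card {z \<in> A. ?g z \<le> ?v}"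
    using A by (intro card_mono) auto
  moreover have "card A div 2 < card {z \<in> A. f z \<le> ?v}"
    using iff[of "\<lambda>y. y \<le> ?v" f] by auto
  ultimately have le: "median_on A ?g \<le> ?v"
    using iff[of "\<lambda>y. y \<le> ?v" ?g] by auto
  have "card {z \<in> A. ?g z < ?v} \<le> card {z \<in> A. f z < ?v}"
    using A by (intro card_mono) (auto split: if_splits)
  moreover have "\<not> card A div 2 < card {z \<in> A. f z < ?v}"
    using iff[of "\<lambda>y. y < ?v" f] by auto
  ultimately have "\<not> median_on A ?g < ?v"
    using iff[of "\<lambda>y. y < ?v" ?g] by auto
  with le show ?thesis by simp
qed

text \<open>
  The neighbourhoods of the complete graph on \<open>V\<close>, completed to odd size: each vertex has
  \<open>card V - 1\<close> neighbours, so it belongs to its own neighbourhood exactly when \<open>card V\<close> is odd.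
\<close>

definition odd_nbhd :: "'v set \<Rightarrow> 'v \<Rightarrow> 'v set" where
  "odd_nbhd V y = (if odd (card V) then V else V - {y})"

text \<open>
  A graph has no multiple arcs, so the out-degree counts the neighbours and not just the arcs.
\<close>

lemma median_nbhd_complete_digraph:
  assumes "K\<^bsub>N\<^esub> G" "y \<in> verts G"
  shows "median_nbhd G y = odd_nbhd (verts G) y"
proof -
  interpret graph G using assms(1) by (simp add: complete_digraph_def)
  have adj: "{z. y \<rightarrow>\<^bsub>G\<^esub> z} = verts G - {y}"
    using assms by (auto simp: complete_digraph_def)
  have "inj_on (head G) (out_arcs G y)"
    using no_multi_arcs by (auto simp: inj_on_def arc_to_ends_def)
  moreover have "head G ` out_arcs G y = {z. y \<rightarrow>\<^bsub>G\<^esub> z}"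
    by (force simp: arcs_ends_def arc_to_ends_def)
  ultimately have "out_degree G y = card (verts G - {y})"
    by (metis adj card_image out_degree_def)
  then show ?thesis
    using assms(2) adj finite_verts
    by (auto simp: median_nbhd_def odd_nbhd_def Let_def card_Diff_singleton_if card_gt_0_iff)
qed

lemma finite_odd_nbhd [simp]: "finite V \<Longrightarrow> finite (odd_nbhd V y)"
  and odd_nbhd_subset: "odd_nbhd V y \<subseteq> V"
  by (auto simp: odd_nbhd_def)

lemma card_odd_nbhd:
  assumes "finite V" "y \<in> V"
  shows "card (odd_nbhd V y) = 2 * ((card V - 1) div 2) + 1"
  using assms card_gt_0_iff[of V] by (auto simp: odd_nbhd_def elim!: oddE evenE)

text \<open>
  If \<open>V\<close> has odd size, all neighbourhoods are equal and this is
  \<open>median_on_fun_upd_median\<close>. If \<open>V\<close> has even size, the neighbourhoods of \<open>x\<close> and \<open>y\<close> differ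
  only in that one contains \<open>y\<close> and the other \<open>x\<close>. After the update \<open>y\<close> carries \<open>v\<close>, so \<open>x\<close> sees
  the family that \<open>y\<close> would see if the value of \<open>x\<close> were replaced by the median \<open>v\<close>.
\<close>

lemma consensus_after_first_update:
  fixes f :: "'v \<Rightarrow> real"
  assumes V: "finite V" "x \<in> V" "y \<in> V"
  defines "v \<equiv> median_on (odd_nbhd V y) f"
  shows "median_on (odd_nbhd V x) (f(y := v)) = v"
proof (cases "x = y \<or> odd (card V)")
  case True
  then have "odd_nbhd V x = odd_nbhd V y" by (auto simp: odd_nbhd_def)
  then show ?thesis
    unfolding v_def using V by (simp add: median_on_fun_upd_median card_odd_nbhd)
next
  case False
  then have nb: "odd_nbhd V z = V - {z}" for z by (simp add: odd_nbhd_def)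
  \<comment> \<open>The neighbourhoods of \<open>x\<close> and \<open>y\<close> share the set \<open>?C\<close>.\<close>
  let ?C = "V - {x, y}"
  have split: "mset_set (V - {u}) = add_mset w (mset_set (V - {u, w}))" if "w \<in> V" "w \<noteq> u" for u w
    using V(1) that mset_set.remove[of "V - {u}" w] by (simp add: Diff_insert[symmetric] insert_commute)
  have "mset_set (V - {x}) = add_mset y (mset_set ?C)"
    using V False by (intro split) auto
  moreover have "mset_set (V - {y}) = add_mset x (mset_set ?C)"
    using V False split[of x y] by (simp add: insert_commute)
  moreover have "image_mset (f(y := v)) (mset_set ?C) = image_mset (f(x := v)) (mset_set ?C)"
    using V by (intro image_mset_cong) auto
  ultimately have "image_mset (f(y := v)) (mset_set (V - {x})) = image_mset (f(x := v)) (mset_set (V - {y}))"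
    by simp
  moreover have "card (V - {x}) = card (V - {y})" using V by simp
  ultimately have "median_on (odd_nbhd V x) (f(y := v)) = median_on (odd_nbhd V y) (f(x := v))"
    by (simp add: median_on_def nb)
  also have "\<dots> = v"
    unfolding v_def using V by (simp add: median_on_fun_upd_median card_odd_nbhd)
  finally show ?thesis .
qed

text \<open>
  In the application \<open>S\<close> is the set of vertices that have rung so far; describing the configuration
  by this set covers rings in any order, simultaneous ones included.
\<close>

lemma consensus_preserved:
  fixes f :: "'v \<Rightarrow> real"
  assumes V: "finite V" "x \<in> V" "y \<in> V" and S: "finite S" "y \<in> S"
  defines "v \<equiv> median_on (odd_nbhd V y) f"
  shows "median_on (odd_nbhd V x) (\<lambda>z. if z \<in> S then v else f z) = v"
proof -
  have "median_on (odd_nbhd V x) (\<lambda>z. if z \<in> insert y T then v else f z) = v" if "finite T" for T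
    using that
  proof (induction T)
    case empty
    show ?case
      using consensus_after_first_update[OF V, of f] unfolding v_def by (simp add: fun_upd_def)
  next
    case (insert w T)
    let ?g = "\<lambda>z. if z \<in> insert y T then v else f z"
    have "(\<lambda>z. if z \<in> insert y (insert w T) then v else f z) = ?g(w := median_on (odd_nbhd V x) ?g)"
      unfolding insert.IH by auto
    then show ?case
      using median_on_fun_upd_median[of "odd_nbhd V x" ?g w] V insert.IH
      by (simp add: card_odd_nbhd)
  qed
  from this[OF S(1)] show ?thesis using S(2) by (simp add: insert_absorb)
qed


section \<open>Solving the dynamics path by path\<close>

lemma ring_imp_ge_first:
  assumes "\<And>n. 0 < W n" "s \<in> rings W"
  shows "W 0 \<le> s"
proof -
  obtain n where "s = (\<Sum>k\<le>n. W k)" using assms(2) by (auto simp: rings_def)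
  moreover have "(\<Sum>k\<in>{0}. W k) \<le> (\<Sum>k\<le>n. W k)"
    using assms(1) by (intro sum_mono2) (auto intro: less_imp_le)
  ultimately show ?thesis by simp
qed

lemma first_in_rings: "W 0 \<in> rings W"
  unfolding rings_def by (intro CollectI exI[of _ 0]) simp

text \<open>
  Waiting times that are at least \<open>1\<close> infinitely often do not tend to \<open>0\<close>, so they are not
  summable and the rings are unbounded.
\<close>

lemma rings_locally_finite:
  assumes pos: "\<And>n. 0 < W n" and inf: "\<exists>\<^sub>F n in sequentially. 1 \<le> W n"
  shows "finite (rings W \<inter> {..t})"
proof -
  have "\<exists>n. t < (\<Sum>k\<le>n. W k)"
  proof (rule ccontr)
    assume "\<nexists>n. t < (\<Sum>k\<le>n. W k)"
    then have "(\<Sum>k\<le>n. W k) \<le> t" for n by (auto simp: not_less)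
    then have "summable W"
      using pos by (intro bounded_imp_summable[of W t]) (auto intro: less_imp_le)
    then have "W \<longlonglongrightarrow> 0" by (rule summable_LIMSEQ_zero)
    then have "\<forall>\<^sub>F n in sequentially. W n < 1" by (rule order_tendstoD) simp
    with inf show False by (auto simp: frequently_def not_le)
  qed
  then obtain n where n: "t < (\<Sum>k\<le>n. W k)" ..
  have "rings W \<inter> {..t} \<subseteq> (\<lambda>m. \<Sum>k\<le>m. W k) ` {..<n}"
  proof
    fix s assume "s \<in> rings W \<inter> {..t}"
    then obtain m where m: "s = (\<Sum>k\<le>m. W k)" "s \<le> t" by (auto simp: rings_def)
    have "m < n"
    proof (rule ccontr)
      assume "\<not> m < n"
      then have "(\<Sum>k\<le>n. W k) \<le> (\<Sum>k\<le>m. W k)"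
        using pos by (intro sum_mono2) (auto intro: less_imp_le)
      with n m show False by simp
    qed
    with m show "s \<in> (\<lambda>m. \<Sum>k\<le>m. W k) ` {..<n}" by auto
  qed
  then show ?thesis by (rule finite_subset) simp
qed

text \<open>
  The deterministic heart of the proof. It works by induction on the number of rings up to
  time \<open>t\<close>. Between the last such ring \<open>s\<close> and the one before it the configuration is constant, so the left limits at \<open>s\<close> exist and are given by the induction hypothesis. If \<open>s\<close> is the first
  ring of all, then only \<open>y\<close> rings at \<open>s\<close>, and it takes the value \<open>v\<close> by definition; at any later
  ring all neighbourhood medians equal \<open>v\<close> by \<open>consensus_preserved\<close>.
\<close>

lemma path_of_first_ring:
  fixes V :: "'v set" and e :: "real \<Rightarrow> 'v \<Rightarrow> real" and W :: "'v \<Rightarrow> nat \<Rightarrow> real"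
  assumes V: "finite V"
    and pos: "\<And>z n. z \<in> V \<Longrightarrow> 0 < W z n"
    and fin: "\<And>z t. z \<in> V \<Longrightarrow> finite (rings (W z) \<inter> {..t})"
    and y: "y \<in> V" "\<And>z. z \<in> V - {y} \<Longrightarrow> W y 0 < W z 0"
    and update: "\<And>z s. z \<in> V \<Longrightarrow> s \<in> rings (W z) \<Longrightarrow>
        e s z = median_on (odd_nbhd V z) (\<lambda>u. Lim (at_left s) (\<lambda>r. e r u))"
    and no_update: "\<And>z s t. z \<in> V \<Longrightarrow> 0 \<le> s \<Longrightarrow> s \<le> t \<Longrightarrow> {s<..t} \<inter> rings (W z) = {} \<Longrightarrow>
        e t z = e s z"
    and "0 \<le> t" "x \<in> V"
  shows "e t x = (if t < W x 0 then e 0 x else median_on (odd_nbhd V y) (e 0))"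
proof -
  define v where "v = median_on (odd_nbhd V y) (e 0)"
  define R where "R t = (\<Union>z\<in>V. rings (W z)) \<inter> {..t}" for t
  have finR: "finite (R t)" for t
  proof -
    have "finite (\<Union>z\<in>V. rings (W z) \<inter> {..t})" using V fin by blast
    then show ?thesis by (rule rev_finite_subset) (auto simp: R_def)
  qed
  have ring_ge: "W z 0 \<le> s" if "z \<in> V" "s \<in> rings (W z)" for z s
    using ring_imp_ge_first[of "W z"] pos that by blast
  have "\<forall>x\<in>V. e t x = (if t < W x 0 then e 0 x else v)" if "0 \<le> t" for t
    using that
  proof (induction "card (R t)" arbitrary: t rule: less_induct)
    case less
    show ?case
    proof (cases "R t = {}")
      case True
      have "e t x = e 0 x" "t < W x 0" if "x \<in> V" for x
      proof -
        show "e t x = e 0 x"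
          using True that less.prems by (intro no_update) (auto simp: R_def)
        show "t < W x 0"
          using True that first_in_rings[of "W x"] by (force simp: R_def)
      qed
      then show ?thesis by simp
    next
      case False
      define s where "s = Max (R t)"
      have s: "s \<in> R t" and s_max: "\<And>r. r \<in> R t \<Longrightarrow> r \<le> s"
        using False finR by (auto simp: s_def)
      have "s \<le> t" using s by (simp add: R_def)
      obtain z0 where z0: "z0 \<in> V" "s \<in> rings (W z0)" using s by (auto simp: R_def)
      have s_pos: "0 < s"
        using ring_ge[OF z0] pos[OF z0(1), of 0] by simp
      \<comment> \<open>\<open>s'\<close> is the last ring before \<open>s\<close>, or \<open>0\<close> if \<open>s\<close> is the first one.\<close>
      define s' where "s' = Max (insert 0 (R t - {s}))"
      have s': "0 \<le> s'" "s' < s" and s'_max: "\<And>r. r \<in> R t \<Longrightarrow> r \<noteq> s \<Longrightarrow> r \<le> s'"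
      proof -
        show "0 \<le> s'" using finR by (auto simp: s'_def)
        have "s' \<in> insert 0 (R t - {s})" unfolding s'_def using finR by (intro Max_in) auto
        then show "s' < s" using s_pos s_max by fastforce
        show "\<And>r. r \<in> R t \<Longrightarrow> r \<noteq> s \<Longrightarrow> r \<le> s'" using finR by (auto simp: s'_def)
      qed
      have quiet: "\<not> (s' < r \<and> r < s)" "\<not> (s < r \<and> r \<le> t)" if "z \<in> V" "r \<in> rings (W z)" for r z
      proof -
        have "r \<in> R t" if "r \<le> t"
          using that \<open>z \<in> V\<close> \<open>r \<in> rings (W z)\<close> by (auto simp: R_def)
        then show "\<not> (s' < r \<and> r < s)" "\<not> (s < r \<and> r \<le> t)"
          using s'_max[of r] s_max[of r] \<open>s \<le> t\<close> by auto
      qed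
      have before: "e r z = e s' z" if "z \<in> V" "s' \<le> r" "r < s" for r z
        using that s' quiet(1)[OF that(1)] by (intro no_update) fastforce+
      have after: "e t z = e s z" if "z \<in> V" for z
        using that s' \<open>s \<le> t\<close> quiet(2)[OF that(1)] by (intro no_update) fastforce+
      have left_lim: "Lim (at_left s) (\<lambda>r. e r z) = e s' z" if "z \<in> V" for z
      proof (rule tendsto_Lim)
        have "\<forall>\<^sub>F r in at_left s. e r z = e s' z"
          using eventually_at_left_real[OF s'(2)]
          by (rule eventually_mono) (rule before[OF that], auto)
        then show "((\<lambda>r. e r z) \<longlongrightarrow> e s' z) (at_left s)"
          by (rule tendsto_eventually)
      qed simp
      have "R s' \<subseteq> R t - {s}" using s' \<open>s \<le> t\<close> by (auto simp: R_def)
      then have "card (R s') < card (R t)"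
        using finR s by (intro psubset_card_mono) auto
      from less.hyps[OF this s'(1)]
      have IH: "e s' z = (if s' < W z 0 then e 0 z else v)" if "z \<in> V" for z
        using that by blast
      have ring: "e s z = v" if z: "z \<in> V" "s \<in> rings (W z)" for z
      proof -
        have "e s z = median_on (odd_nbhd V z) (\<lambda>u. Lim (at_left s) (\<lambda>r. e r u))"
          using z by (rule update)
        also have "\<dots> = median_on (odd_nbhd V z) (\<lambda>u. if s' < W u 0 then e 0 u else v)"
          using odd_nbhd_subset[of V z] left_lim IH by (intro median_on_cong) auto
        also have "\<dots> = v"
        proof (cases "s' < W y 0")
          case True
          then have before_first: "s' < W u 0" if "u \<in> V" for u
            using y(2)[of u] that by (cases "u = y") auto
          \<comment> \<open>No ring precedes \<open>s\<close>, so \<open>s\<close> is the first ring of \<open>y\<close> and \<open>z\<close> cannot be another vertex.\<close>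
          have "s \<le> W y 0"
            using quiet(1)[OF y(1) first_in_rings] True by auto
          moreover have "W z 0 \<le> s" using z by (rule ring_ge)
          ultimately have "z = y" using y(2)[of z] z(1) by force
          then show ?thesis
            unfolding v_def \<open>z = y\<close> using odd_nbhd_subset[of V y] before_first
            by (intro median_on_cong) auto
        next
          case False
          \<comment> \<open>The vertices that have rung by time \<open>s'\<close>; they include \<open>y\<close>.\<close>
          let ?S = "{u \<in> V. \<not> s' < W u 0}"
          have "median_on (odd_nbhd V z) (\<lambda>u. if s' < W u 0 then e 0 u else v)
              = median_on (odd_nbhd V z) (\<lambda>u. if u \<in> ?S then v else e 0 u)"
            using odd_nbhd_subset[of V z] by (intro median_on_cong) auto
          also have "\<dots> = v"
            unfolding v_def using V z y False by (intro consensus_preserved) auto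
          finally show ?thesis .
        qed
        finally show ?thesis .
      qed
      show ?thesis
      proof
        fix z assume z: "z \<in> V"
        show "e t z = (if t < W z 0 then e 0 z else v)"
        proof (cases "s \<in> rings (W z)")
          case True
          then have "W z 0 \<le> t" using ring_ge[OF z] \<open>s \<le> t\<close> by force
          then show ?thesis using ring[OF z True] after[OF z] by simp
        next
          case False
          have "\<not> (s' < r \<and> r \<le> s)" if "r \<in> rings (W z)" for r
            using quiet(1)[OF z that] that False by (cases "r = s") auto
          then have "e s z = e s' z"
            using z s' by (intro no_update) auto
          moreover have "s' < W z 0 \<longleftrightarrow> t < W z 0"
          proof -
            have "W z 0 \<noteq> s" using False first_in_rings[of "W z"] by auto
            then show ?thesis
              using quiet[OF z first_in_rings] s' \<open>s \<le> t\<close> by auto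
          qed
          ultimately show ?thesis using after[OF z] IH[OF z] by simp
        qed
      qed
    qed
  qed
  then show ?thesis using assms unfolding v_def by blast
qed


section \<open>Binomial majority probabilities\<close>

definition majority_prob :: "nat \<Rightarrow> real \<Rightarrow> real" where
  "majority_prob k a = (\<Sum>j=k+1..2*k+1. real ((2*k+1) choose j) * a ^ j * (1 - a) ^ (2*k+1-j))"

text \<open>
  The density of the Beta distribution with both parameters \<open>k + 1\<close>, which is the law of the
  median of \<open>2 k + 1\<close> independent uniform variables.
\<close>

definition majority_density :: "nat \<Rightarrow> real \<Rightarrow> real" where
  "majority_density k a = real (k+1) * real ((2*k+1) choose (k+1)) * (a * (1 - a)) ^ k"

text \<open>
  The derivative of the summand \<open>(n choose j) a^j (1 - a)^(n - j)\<close> is a difference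
  \<open>D\<^sub>j - D\<^sub>j\<^sub>+\<^sub>1\<close> with \<open>D\<^sub>j = j (n choose j) a^(j - 1) (1 - a)^(n - j)\<close>, because
  \<open>(n - j) (n choose j) = (j + 1) (n choose (j + 1))\<close>. So the sum telescopes to \<open>D\<^sub>m\<close>.
\<close>

lemma DERIV_binomial_tail:
  fixes a :: real
  assumes "1 \<le> m" "m \<le> n + 1"
  shows "((\<lambda>a. \<Sum>j=m..n. real (n choose j) * a ^ j * (1 - a) ^ (n - j)) has_real_derivative
           real m * real (n choose m) * a ^ (m - 1) * (1 - a) ^ (n - m)) (at a)"
  using assms(2,1)
proof (induction rule: inc_induct)
  case base
  show ?case by (simp add: binomial_eq_0)
next
  case (step m)
  have absorb: "real (Suc m) * real (n choose Suc m) = real (n - m) * real (n choose m)"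
    using binomial_absorb_comp[of n m] binomial_absorption[of m n]
    by (metis of_nat_mult binomial_absorption binomial_absorb_comp)
  have "(\<lambda>a::real. \<Sum>j=m..n. real (n choose j) * a ^ j * (1 - a) ^ (n - j)) =
      (\<lambda>a. real (n choose m) * a ^ m * (1 - a) ^ (n - m) +
        (\<Sum>j=Suc m..n. real (n choose j) * a ^ j * (1 - a) ^ (n - j)))"
    using step by (simp add: sum.atLeast_Suc_atMost)
  moreover have "((\<lambda>a. real (n choose m) * a ^ m * (1 - a) ^ (n - m)) has_real_derivative
      real m * real (n choose m) * a ^ (m - 1) * (1 - a) ^ (n - m)
      - real (n - m) * real (n choose m) * a ^ m * (1 - a) ^ (n - Suc m)) (at a)"
    by (auto intro!: derivative_eq_intros simp: algebra_simps)
  note DERIV_add[OF this step.IH]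
  ultimately show ?case
    using absorb by simp
qed

lemma DERIV_majority_prob:
  "(majority_prob k has_real_derivative majority_density k a) (at a)"
  using DERIV_binomial_tail[of "k+1" "2*k+1" a]
  by (simp add: majority_prob_def[abs_def] majority_density_def power_mult_distrib mult_ac)

lemma majority_density_nonneg: "0 \<le> a \<Longrightarrow> a \<le> 1 \<Longrightarrow> 0 \<le> majority_density k a"
  by (simp add: majority_density_def)

lemma majority_density_symmetric: "majority_density k (1 - a) = majority_density k a"
  by (simp add: majority_density_def mult.commute)

lemma majority_density_mono:
  assumes "0 \<le> a" "a \<le> b" "b \<le> 1/2"
  shows "majority_density k a \<le> majority_density k b"
proof -
  have "0 \<le> (b - a) * (1 - a - b)" using assms by simp
  then have "a * (1 - a) \<le> b * (1 - b)" by (simp add: algebra_simps)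
  then show ?thesis
    unfolding majority_density_def using assms by (intro mult_left_mono power_mono) auto
qed

lemma majority_prob_0: "majority_prob k 0 = 0"
  by (auto simp: majority_prob_def intro!: sum.neutral)

lemma majority_prob_1: "majority_prob k 1 = 1"
proof -
  have "majority_prob k 1 = (\<Sum>j=k+1..2*k+1. if j = 2*k+1 then 1 else 0)"
    unfolding majority_prob_def by (intro sum.cong) auto
  then show ?thesis by (simp add: sum.delta')
qed

text \<open>
  By the symmetry of its derivative, \<open>h(a) + h(1 - a)\<close> is constant, and at \<open>a = 0\<close> it is \<open>1\<close>.
\<close>

lemma majority_prob_half: "majority_prob k (1/2) = 1/2"
proof -
  let ?g = "\<lambda>a. majority_prob k a + majority_prob k (1 - a)"
  have "(?g has_real_derivative 0) (at a)" for a
    by (auto intro!: derivative_eq_intros DERIV_chain'[where g="majority_prob k"] DERIV_majority_prob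
        simp: majority_density_symmetric)
  then have "?g (1/2) = ?g 0" by (intro DERIV_isconst_all) auto
  then show ?thesis by (simp add: majority_prob_0 majority_prob_1)
qed

text \<open>
  The function is convex on \<open>[0, 1/2]\<close>, hence below the chord between its end points
  \<open>(0, 0)\<close> and \<open>(1/2, 1/2)\<close>.
\<close>

lemma majority_prob_le:
  assumes "0 \<le> a" "a \<le> 1/2"
  shows "majority_prob k a \<le> a"
proof -
  have "convex_on {0..1/2} (majority_prob k)"
    by (rule convex_on_realI[where f'="majority_density k"])
       (auto intro: DERIV_majority_prob majority_density_mono)
  then have "majority_prob k ((1 - 2*a) *\<^sub>R 0 + (2*a) *\<^sub>R (1/2)) \<le>
      (1 - 2*a) * majority_prob k 0 + (2*a) * majority_prob k (1/2)"
    using assms by (intro convex_onD) auto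
  then show ?thesis by (simp add: majority_prob_0 majority_prob_half)
qed


section \<open>Independent families of real variables\<close>

lemma (in prob_space) indep_vars_reindex_inj:
  assumes "indep_vars M' X I" "inj_on f J" "f ` J \<subseteq> I"
  shows "indep_vars (\<lambda>j. M' (f j)) (\<lambda>j. X (f j)) J"
proof -
  \<comment> \<open>Grouping a family into singleton blocks is a reindexing.\<close>
  have "indep_vars (\<lambda>j. PiM {f j} M') (\<lambda>j \<omega>. restrict (\<lambda>i. X i \<omega>) {f j}) J"
    using assms by (intro indep_vars_restrict) (auto simp: disjoint_family_on_def inj_on_def)
  then have "indep_vars (\<lambda>j. M' (f j)) (\<lambda>j \<omega>. (restrict (\<lambda>i. X i \<omega>) {f j}) (f j)) J"
    by (rule indep_vars_compose2) (simp add: measurable_component_singleton)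
  then show ?thesis by simp
qed

text \<open>
  The joint law is the product law, and under it the diagonal is a null set by Fubini since the
  law of \<open>Y\<close> has no atoms. This excludes ties between first rings.
\<close>

lemma (in prob_space) AE_indep_neq:
  fixes X Y :: "'a \<Rightarrow> real"
  assumes indep: "indep_var borel X borel Y" and Y: "distributed M lborel Y f"
  shows "AE \<omega> in M. X \<omega> \<noteq> Y \<omega>"
proof -
  have [measurable]: "X \<in> borel_measurable M" "Y \<in> borel_measurable M"
    using indep indep_var_rv1 indep_var_rv2 by blast+
  interpret Y: prob_space "distr M borel Y" by (rule prob_space_distr) simp
  have null: "emeasure (distr M borel Y) {c} = 0" for c
  proof -
    have "emeasure (distr M borel Y) {c} = emeasure M (Y -` {c} \<inter> space M)"
      by (simp add: emeasure_distr)
    also have "\<dots> = (\<integral>\<^sup>+y. f y * indicator {c} y \<partial>lborel)"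
      using Y by (rule distributed_emeasure) simp
    also have "\<dots> = 0"
      using Y by (subst nn_integral_0_iff_AE) (auto intro!: AE_I'[of "{c}"])
    finally show ?thesis .
  qed
  let ?D = "{p :: real \<times> real. fst p = snd p}"
  have "{p \<in> space (borel \<Otimes>\<^sub>M borel). fst p = (snd p :: real)} \<in> sets (borel \<Otimes>\<^sub>M borel)"
    by measurable
  then have D: "?D \<in> sets (borel \<Otimes>\<^sub>M borel)" by (simp add: space_pair_measure)
  have "emeasure M {\<omega> \<in> space M. X \<omega> = Y \<omega>} =
      emeasure (distr M (borel \<Otimes>\<^sub>M borel) (\<lambda>\<omega>. (X \<omega>, Y \<omega>))) ?D"
    using D by (subst emeasure_distr) (auto intro!: arg_cong2[where f=emeasure])
  also have "\<dots> = emeasure (distr M borel X \<Otimes>\<^sub>M distr M borel Y) ?D"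
    using indep by (simp add: indep_var_distribution_eq)
  also have "\<dots> = (\<integral>\<^sup>+c. emeasure (distr M borel Y) (Pair c -` ?D) \<partial>distr M borel X)"
    using D by (intro Y.emeasure_pair_measure_alt) (simp cong: sets_pair_measure_cong)
  also have "\<dots> = (\<integral>\<^sup>+c. emeasure (distr M borel Y) {c} \<partial>distr M borel X)"
    by (intro nn_integral_cong arg_cong2[where f=emeasure]) auto
  finally have "emeasure M {\<omega> \<in> space M. X \<omega> = Y \<omega>} = 0" by (simp add: null)
  then show ?thesis by (subst AE_iff_measurable[OF _ refl]) auto
qed

text \<open>
  The median is at most \<open>a\<close> when more than \<open>k\<close> of the variables are. The events on which exactly
  the variables in a given \<open>S \<subseteq> A\<close> are at most \<open>a\<close> are disjoint, each has a product probability
  that depends on \<open>card S\<close> only, and there are \<open>(2 k + 1) choose j\<close> sets of size \<open>j\<close>.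
\<close>

lemma (in prob_space) prob_median_le:
  fixes X :: "'v \<Rightarrow> 'a \<Rightarrow> real"
  assumes indep: "indep_vars (\<lambda>_. borel) X A" and A: "finite A" "card A = 2 * k + 1"
    and p: "\<And>z. z \<in> A \<Longrightarrow> prob {\<omega> \<in> space M. X z \<omega> \<le> a} = p"
  shows "prob {\<omega> \<in> space M. median_on A (\<lambda>z. X z \<omega>) \<le> a} = majority_prob k p"
proof -
  have rv: "X z \<in> borel_measurable M" if "z \<in> A" for z
    using indep that by (auto simp: indep_vars_def)
  define I where "I S z = (if z \<in> S then {..a} else {a<..})" for S and z :: 'v
  define E where "E S = (\<Inter>z\<in>A. X z -` I S z \<inter> space M)" for S
  have "A \<noteq> {}" using A by auto
  have E_iff: "\<omega> \<in> E S \<longleftrightarrow> \<omega> \<in> space M \<and> {z \<in> A. X z \<omega> \<le> a} = S" if "S \<subseteq> A" for S \<omega>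
    using that \<open>A \<noteq> {}\<close> by (auto simp: E_def I_def split: if_splits)
  have E_sets: "E S \<in> events" for S
    unfolding E_def using A \<open>A \<noteq> {}\<close> rv
    by (intro sets.finite_INT) (auto simp: I_def intro!: measurable_sets[where A=borel])
  have prob_E: "prob (E S) = p ^ card S * (1 - p) ^ (2 * k + 1 - card S)" if "S \<subseteq> A" for S
  proof -
    have "prob (X z -` I S z \<inter> space M) = (if z \<in> S then p else 1 - p)" if z: "z \<in> A" for z
    proof -
      have le: "{\<omega> \<in> space M. X z \<omega> \<le> a} \<in> events" using rv[OF z] by measurable
      have eq: "X z -` {..a} \<inter> space M = {\<omega> \<in> space M. X z \<omega> \<le> a}"
        "X z -` {a<..} \<inter> space M = space M - {\<omega> \<in> space M. X z \<omega> \<le> a}" by auto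
      show ?thesis
        using prob_compl[OF le] p[OF z] eq by (simp add: I_def)
    qed
    moreover have "prob (E S) = (\<Prod>z\<in>A. prob (X z -` I S z \<inter> space M))"
      unfolding E_def using indep \<open>A \<noteq> {}\<close> A(1)
      by (rule indep_varsD_finite) (auto simp: I_def)
    ultimately have "prob (E S) = (\<Prod>z\<in>A. if z \<in> S then p else 1 - p)" by simp
    also have "\<dots> = p ^ card (A \<inter> S) * (1 - p) ^ card (A - S)"
      using A by (simp add: prod.If_cases Diff_eq)
    also have "A \<inter> S = S" using that by auto
    also have "card (A - S) = 2 * k + 1 - card S"
      using that A by (subst card_Diff_subset) (auto intro: finite_subset)
    finally show ?thesis .
  qed
  have med: "median_on A f \<le> a \<longleftrightarrow> k < card {z \<in> A. f z \<le> a}" for f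
    using median_on_downward_iff[of A "\<lambda>y. y \<le> a" f] A by auto
  let ?S = "\<lambda>j. {S. S \<subseteq> A \<and> card S = j}"
  have card_le: "card S \<le> 2 * k + 1" if "S \<subseteq> A" for S
    using card_mono[OF A(1) that] A by simp
  have fin: "finite (?S j)" for j using A by simp
  have "{\<omega> \<in> space M. median_on A (\<lambda>z. X z \<omega>) \<le> a} = (\<Union>S\<in>(\<Union>j\<in>{k+1..2*k+1}. ?S j). E S)"
  proof (intro set_eqI iffI)
    fix \<omega> assume \<omega>: "\<omega> \<in> {\<omega> \<in> space M. median_on A (\<lambda>z. X z \<omega>) \<le> a}"
    let ?T = "{z \<in> A. X z \<omega> \<le> a}"
    have "?T \<subseteq> A" by auto
    then show "\<omega> \<in> (\<Union>S\<in>(\<Union>j\<in>{k+1..2*k+1}. ?S j). E S)"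
      using \<omega> med[of "\<lambda>z. X z \<omega>"] card_le[of ?T] E_iff[of ?T \<omega>]
      by (intro UN_I[of ?T] UN_I[of "card ?T"]) auto
  next
    fix \<omega> assume "\<omega> \<in> (\<Union>S\<in>(\<Union>j\<in>{k+1..2*k+1}. ?S j). E S)"
    then obtain S where S: "S \<subseteq> A" "k < card S" "\<omega> \<in> E S" by auto
    then show "\<omega> \<in> {\<omega> \<in> space M. median_on A (\<lambda>z. X z \<omega>) \<le> a}"
      using E_iff[OF S(1), of \<omega>] med[of "\<lambda>z. X z \<omega>"] by auto
  qed
  also have "prob \<dots> = (\<Sum>S\<in>(\<Union>j\<in>{k+1..2*k+1}. ?S j). prob (E S))"
  proof (rule finite_measure_finite_Union)
    show "finite (\<Union>j\<in>{k+1..2*k+1}. ?S j)" using fin by blast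
    show "disjoint_family_on E (\<Union>j\<in>{k+1..2*k+1}. ?S j)"
    unfolding disjoint_family_on_def proof (intro ballI impI)
      fix S T
      assume "S \<in> (\<Union>j\<in>{k+1..2*k+1}. ?S j)" "T \<in> (\<Union>j\<in>{k+1..2*k+1}. ?S j)" "S \<noteq> T"
      then have "S \<subseteq> A" "T \<subseteq> A" by simp_all
      show "E S \<inter> E T = {}"
      proof (rule equals0I)
        fix \<omega> assume "\<omega> \<in> E S \<inter> E T"
        then have "\<omega> \<in> E S" "\<omega> \<in> E T" by simp_all
        then have "{z \<in> A. X z \<omega> \<le> a} = S" "{z \<in> A. X z \<omega> \<le> a} = T"
          using E_iff[OF \<open>S \<subseteq> A\<close>] E_iff[OF \<open>T \<subseteq> A\<close>] by blast+
        with \<open>S \<noteq> T\<close> show False by simp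
      qed
    qed
  qed (use E_sets in auto)
  also have "\<dots> = (\<Sum>j=k+1..2*k+1. \<Sum>S\<in>?S j. prob (E S))"
    by (rule sum.UNION_disjoint) (use fin in auto)
  also have "\<dots> = (\<Sum>j=k+1..2*k+1. real ((2*k+1) choose j) * p ^ j * (1 - p) ^ (2*k+1-j))"
  proof (rule sum.cong[OF refl])
    fix j
    have "(\<Sum>S\<in>?S j. prob (E S)) = (\<Sum>S\<in>?S j. p ^ j * (1 - p) ^ (2*k+1-j))"
      using prob_E by (intro sum.cong) auto
    also have "\<dots> = real (card (?S j)) * (p ^ j * (1 - p) ^ (2*k+1-j))"
      by (rule sum_constant)
    also have "card (?S j) = (2*k+1) choose j"
      using n_subsets[OF A(1), of j] A(2) by (simp only:)
    finally show "(\<Sum>S\<in>?S j. prob (E S)) = real ((2*k+1) choose j) * p ^ j * (1 - p) ^ (2*k+1-j)"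
      by (simp only: mult.assoc)
  qed
  also have "\<dots> = majority_prob k p"
    by (simp only: majority_prob_def)
  finally show ?thesis .
qed

lemma pred_median_on_le:
  assumes "finite A" "odd (card A)" "A \<subseteq> V"
  shows "Measurable.pred (PiM V (\<lambda>_. borel)) (\<lambda>f. median_on A f \<le> a)"
proof -
  have "median_on A f \<le> a \<longleftrightarrow> real (card A div 2) < (\<Sum>z\<in>A. indicator {..a} (f z))" for f
  proof -
    have "median_on A f \<le> a \<longleftrightarrow> card A div 2 < card {z \<in> A. f z \<le> a}"
      using assms by (intro median_on_downward_iff) auto
    also have "real (card {z \<in> A. f z \<le> a}) = (\<Sum>z\<in>A. indicator {..a} (f z))"
      using assms by (simp add: indicator_def sum.If_cases Int_def)
    ultimately show ?thesis by (metis of_nat_less_iff)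
  qed
  moreover have [measurable]: "(\<lambda>f. f z) \<in> borel_measurable (PiM V (\<lambda>_. borel))" if "z \<in> A" for z
    using that assms by (intro measurable_component_singleton) auto
  ultimately show ?thesis by simp
qed



section \<open>The clocks and the initial values\<close>

context median_dynamics
begin

lemma initial_indep: "indep_vars (\<lambda>_. borel) (\<eta> 0) (verts G)"
  using indep_vars_reindex_inj[OF independent, of Inl "verts G"] by (auto simp: inj_on_def)

lemma waiting_indep:
  assumes "z \<in> verts G"
  shows "indep_vars (\<lambda>_. borel) (W z) UNIV"
  using indep_vars_reindex_inj[OF independent, of "\<lambda>n. Inr (z, n)" UNIV] assms
  by (auto simp: inj_on_def)

lemma first_ring_indep: "indep_vars (\<lambda>_. borel) (\<lambda>z. W z 0) (verts G)"
  using indep_vars_reindex_inj[OF independent, of "\<lambda>z. Inr (z, 0)" "verts G"]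
  by (auto simp: inj_on_def)

text \<open>
  The index sets of the two families are disjoint parts of the index set of the mutually
  independent family of all initial values and waiting times; here both are reindexed by the
  vertices.
\<close>

lemma initial_indep_first_ring:
  "indep_var (PiM (verts G) (\<lambda>_. borel)) (\<lambda>\<omega>. \<lambda>z\<in>verts G. \<eta> 0 z \<omega>)
             (PiM (verts G) (\<lambda>_. borel)) (\<lambda>\<omega>. \<lambda>z\<in>verts G. W z 0 \<omega>)"
proof -
  let ?X = "case_sum (\<lambda>x. \<eta> 0 x) (\<lambda>(x, n). W x n)"
  let ?A = "Inl ` verts G :: ('v + 'v \<times> nat) set"
  let ?B = "(\<lambda>z. Inr (z, 0)) ` verts G :: ('v + 'v \<times> nat) set"
  have "indep_var (PiM ?A (\<lambda>_. borel)) (\<lambda>\<omega>. restrict (\<lambda>i. ?X i \<omega>) ?A)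
                  (PiM ?B (\<lambda>_. borel)) (\<lambda>\<omega>. restrict (\<lambda>i. ?X i \<omega>) ?B)"
    by (rule indep_var_restrict[OF independent]) auto
  then have "indep_var (PiM (verts G) (\<lambda>_. borel))
      ((\<lambda>f. \<lambda>z\<in>verts G. f (Inl z)) \<circ> (\<lambda>\<omega>. restrict (\<lambda>i. ?X i \<omega>) ?A))
      (PiM (verts G) (\<lambda>_. borel))
      ((\<lambda>f. \<lambda>z\<in>verts G. f (Inr (z, 0))) \<circ> (\<lambda>\<omega>. restrict (\<lambda>i. ?X i \<omega>) ?B))"
    by (rule indep_var_compose)
       (auto intro!: measurable_restrict measurable_component_singleton)
  then show ?thesis by (simp add: comp_def cong: restrict_cong)
qed

lemma initial_measurable: "z \<in> verts G \<Longrightarrow> \<eta> 0 z \<in> borel_measurable M"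
  using initial_indep by (auto simp: indep_vars_def)

lemma waiting_measurable: "z \<in> verts G \<Longrightarrow> W z n \<in> borel_measurable M"
  using waiting_indep by (auto simp: indep_vars_def)

lemma prob_initial_and_first_ring:
  assumes "Measurable.pred (PiM (verts G) (\<lambda>_. borel)) P"
    and "Measurable.pred (PiM (verts G) (\<lambda>_. borel)) Q"
  shows "prob {\<omega> \<in> space M. P (\<lambda>z\<in>verts G. \<eta> 0 z \<omega>) \<and> Q (\<lambda>z\<in>verts G. W z 0 \<omega>)}
    = prob {\<omega> \<in> space M. P (\<lambda>z\<in>verts G. \<eta> 0 z \<omega>)} * prob {\<omega> \<in> space M. Q (\<lambda>z\<in>verts G. W z 0 \<omega>)}"
proof -
  let ?M = "PiM (verts G) (\<lambda>_. borel :: real measure)"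
  let ?X = "\<lambda>\<omega>. \<lambda>z\<in>verts G. \<eta> 0 z \<omega>" and ?Y = "\<lambda>\<omega>. \<lambda>z\<in>verts G. W z 0 \<omega>"
  have sets: "{f \<in> space ?M. P f} \<in> sets ?M" "{f \<in> space ?M. Q f} \<in> sets ?M"
    using assms by (simp_all add: pred_def)
  have space: "?X \<omega> \<in> space ?M" "?Y \<omega> \<in> space ?M" for \<omega>
    by (simp_all add: space_PiM)
  from indep_varD[OF initial_indep_first_ring sets] show ?thesis
    using space by (simp add: vimage_def Int_def conj_commute)
qed

lemma prob_initial_le:
  assumes "z \<in> verts G" "0 \<le> a" "a \<le> 1"
  shows "prob {\<omega> \<in> space M. \<eta> 0 z \<omega> \<le> a} = a"
proof -
  have "prob {\<omega> \<in> space M. \<eta> 0 z \<omega> \<le> a} = measure (distr M lborel (\<eta> 0 z)) {..a}"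
    using initial_measurable[OF assms(1)]
    by (subst measure_distr) (auto intro!: arg_cong[where f=prob])
  also have "\<dots> = measure lborel ({0..1} \<inter> {..a})"
    using initial_uniform[OF assms(1)] by (simp add: measure_uniform_measure)
  also have "{0..1} \<inter> {..a} = {0..a}" using assms by auto
  finally show ?thesis using assms by simp
qed

lemma AE_waiting_pos: "AE \<omega> in M. \<forall>z\<in>verts G. \<forall>n. 0 < W z n \<omega>"
proof -
  have "AE \<omega> in M. 0 < W z n \<omega>" if "z \<in> verts G" for z n
  proof -
    have "prob {\<omega> \<in> space M. 0 < W z n \<omega>} = 1"
      using exponential_distributedD_gt[OF waiting_exponential[OF that, of n], of 0] by simp
    then have "AE \<omega> in M. \<omega> \<in> {\<omega> \<in> space M. 0 < W z n \<omega>}" by (rule AE_prob_1)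
    then show ?thesis by (rule eventually_mono) simp
  qed
  then show ?thesis
    using finite_verts by (simp add: AE_finite_all AE_all_countable)
qed

text \<open>
  The probability that all of \<open>K + 1\<close> consecutive waiting times are less than \<open>1\<close> is at most
  \<open>(1 - exp (-1))^(K + 1)\<close>, so almost surely no tail of the sequence stays below \<open>1\<close>.
\<close>

lemma AE_waiting_frequently_ge_1:
  "AE \<omega> in M. \<forall>z\<in>verts G. \<exists>\<^sub>F n in sequentially. 1 \<le> W z n \<omega>"
proof -
  have "AE \<omega> in M. \<not> (\<forall>n\<ge>m. W z n \<omega> < 1)" if z: "z \<in> verts G" for z m
  proof -
    let ?N = "{\<omega> \<in> space M. \<forall>n\<ge>m. W z n \<omega> < 1}"
    let ?q = "1 - exp (- 1) :: real"
    have [measurable]: "W z n \<in> borel_measurable M" for n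
      using z by (rule waiting_measurable)
    have q: "prob (W z n -` {..<1} \<inter> space M) \<le> ?q" for n
    proof -
      have "prob (W z n -` {..<1} \<inter> space M) \<le> prob {\<omega> \<in> space M. W z n \<omega> \<le> 1}"
        by (intro finite_measure_mono) auto
      then show ?thesis
        using exponential_distributedD_le[OF waiting_exponential[OF z, of n], of 1] by simp
    qed
    have "prob ?N \<le> ?q ^ Suc K" for K
    proof -
      have "prob ?N \<le> prob (\<Inter>n\<in>{m..m+K}. W z n -` {..<1} \<inter> space M)"
        by (intro finite_measure_mono) auto
      also have "\<dots> = (\<Prod>n\<in>{m..m+K}. prob (W z n -` {..<1} \<inter> space M))"
        by (rule indep_varsD[OF waiting_indep[OF z]]) auto
      also have "\<dots> \<le> (\<Prod>n\<in>{m..m+K}. ?q)"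
        using q by (intro prod_mono) auto
      finally show ?thesis by simp
    qed
    moreover have "(\<lambda>K. ?q ^ Suc K) \<longlonglongrightarrow> 0"
      by (intro LIMSEQ_Suc LIMSEQ_realpow_zero) auto
    ultimately have "prob ?N \<le> 0"
      by (intro LIMSEQ_le_const[where X="\<lambda>K. ?q ^ Suc K"]) blast+
    then have "prob ?N = 0" using measure_nonneg[of M ?N] by linarith
    then show ?thesis
      by (subst AE_iff_measurable[OF _ refl]) (auto simp: emeasure_eq_measure)
  qed
  then have "AE \<omega> in M. \<forall>z\<in>verts G. \<forall>m. \<not> (\<forall>n\<ge>m. W z n \<omega> < 1)"
    using finite_verts by (simp add: AE_finite_all AE_all_countable)
  then show ?thesis
    by (rule eventually_mono) (auto simp: frequently_sequentially not_less)
qed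

lemma AE_first_ring_unique:
  "AE \<omega> in M. \<forall>y\<in>verts G. \<forall>z\<in>verts G. y \<noteq> z \<longrightarrow> W y 0 \<omega> \<noteq> W z 0 \<omega>"
proof -
  have "AE \<omega> in M. y \<noteq> z \<longrightarrow> W y 0 \<omega> \<noteq> W z 0 \<omega>" if yz: "y \<in> verts G" "z \<in> verts G" for y z
  proof (cases "y = z")
    case False
    have "indep_vars (\<lambda>_. borel) (\<lambda>b. W (if b then y else z) 0) UNIV"
      using yz False
      by (intro indep_vars_reindex_inj[OF first_ring_indep, of "\<lambda>b. if b then y else z"])
         (auto simp: inj_on_def)
    then have "indep_var borel (W y 0) borel (W z 0)"
      unfolding indep_var_def
      by (rule iffD1[OF indep_vars_cong, rotated 3]) (auto split: bool.splits)
    then have "AE \<omega> in M. W y 0 \<omega> \<noteq> W z 0 \<omega>"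
      using waiting_exponential[OF yz(2)] by (rule AE_indep_neq)
    then show ?thesis by simp
  qed simp
  then show ?thesis using finite_verts by (simp add: AE_finite_all)
qed

end


section \<open>The one-point distribution function\<close>

lemma (in median_dynamics) AE_path_complete:
  assumes K: "K\<^bsub>N\<^esub> G" and t: "0 \<le> t" and x: "x \<in> verts G"
  shows "AE \<omega> in M. \<forall>y\<in>verts G. (\<forall>z\<in>verts G - {y}. W y 0 \<omega> < W z 0 \<omega>) \<longrightarrow>
    \<eta> t x \<omega> = (if t < W x 0 \<omega> then \<eta> 0 x \<omega>
      else median_on (odd_nbhd (verts G) y) (\<lambda>z. \<eta> 0 z \<omega>))"
  using AE_waiting_pos AE_waiting_frequently_ge_1 update no_update
proof eventually_elim
  case (elim \<omega>)
  show ?case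
  proof (intro ballI impI)
    fix y assume y: "y \<in> verts G" "\<forall>z\<in>verts G - {y}. W y 0 \<omega> < W z 0 \<omega>"
    show "\<eta> t x \<omega> = (if t < W x 0 \<omega> then \<eta> 0 x \<omega>
        else median_on (odd_nbhd (verts G) y) (\<lambda>z. \<eta> 0 z \<omega>))"
    proof (rule path_of_first_ring[where e="\<lambda>r z. \<eta> r z \<omega>" and W="\<lambda>z n. W z n \<omega>"])
      show "finite (rings (\<lambda>n. W z n \<omega>) \<inter> {..r})" if "z \<in> verts G" for z r
        using elim(1,2) that by (intro rings_locally_finite) auto
      show "\<eta> s z \<omega> = median_on (odd_nbhd (verts G) z) (\<lambda>u. Lim (at_left s) (\<lambda>r. \<eta> r u \<omega>))"
        if "z \<in> verts G" "s \<in> rings (\<lambda>n. W z n \<omega>)" for z s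
        using elim(3) that median_nbhd_complete_digraph[OF K that(1)] by auto
      show "\<eta> r z \<omega> = \<eta> s z \<omega>"
        if "z \<in> verts G" "0 \<le> s" "s \<le> r" "{s<..r} \<inter> rings (\<lambda>n. W z n \<omega>) = {}" for z s r
        using elim(4) that by blast
    qed (use elim(1) y t x finite_verts in auto)
  qed
qed

lemma (in median_dynamics) AE_ex_first_ring:
  assumes "x \<in> verts G"
  shows "AE \<omega> in M. \<exists>y\<in>verts G. \<forall>z\<in>verts G - {y}. W y 0 \<omega> < W z 0 \<omega>"
  using AE_first_ring_unique
proof eventually_elim
  case (elim \<omega>)
  obtain y where y: "y \<in> verts G" "\<And>z. z \<in> verts G \<Longrightarrow> W y 0 \<omega> \<le> W z 0 \<omega>"
    using finite_verts assms ex_min_if_finite[of "(\<lambda>z. W z 0 \<omega>) ` verts G"]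
    by (metis (mono_tags, lifting) arg_min_if_finite(1) arg_min_least empty_iff)
  show ?case
  proof (intro bexI[of _ y] ballI)
    fix z assume "z \<in> verts G - {y}"
    then show "W y 0 \<omega> < W z 0 \<omega>" using y(2)[of z] elim y(1) by force
  qed (rule y(1))
qed

text \<open>
  The event is split, up to a null set, into the case that \<open>x\<close> has not rung and the cases
  that it has and \<open>y\<close> was first, for each \<open>y\<close>. Each case is the intersection of an event of the
  clocks with an event of the initial values. In the second kind the latter has the same probability
  \<open>h(a)\<close> for every \<open>y\<close>, so only the total probability \<open>1 - exp (-t)\<close> of the clock events enters.
\<close>

lemma (in median_dynamics) prob_le_complete:
  assumes K: "K\<^bsub>N\<^esub> G" and t: "0 \<le> t" and x: "x \<in> verts G" and a: "0 \<le> a" "a \<le> 1"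
  shows "prob {\<omega> \<in> space M. \<eta> t x \<omega> \<le> a} =
    exp (- t) * a + (1 - exp (- t)) * majority_prob ((card (verts G) - 1) div 2) a"
proof -
  define k where "k = (card (verts G) - 1) div 2"
  let ?V = "verts G"
  define nb where "nb = odd_nbhd ?V"
  define first where "first y \<omega> \<longleftrightarrow> (\<forall>z\<in>?V - {y}. W y 0 \<omega> < W z 0 \<omega>)" for y \<omega>
  note [simp] = finite_verts
  have nb: "finite (nb y)" "nb y \<subseteq> ?V" "card (nb y) = 2 * k + 1" if "y \<in> ?V" for y
    using that odd_nbhd_subset[of ?V y] by (simp_all add: nb_def k_def card_odd_nbhd)
  have [measurable]: "W z 0 \<in> borel_measurable M" "\<eta> 0 z \<in> borel_measurable M" if "z \<in> ?V" for z
    using that by (simp_all add: waiting_measurable initial_measurable)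
  have [measurable]: "\<eta> t x \<in> borel_measurable M"
    using measurable_restrict_space2_iff state[OF t x] by blast
  have comp [measurable]: "(\<lambda>f. f z) \<in> borel_measurable (PiM ?V (\<lambda>_. borel :: real measure))" if "z \<in> ?V" for z
    using that by (rule measurable_component_singleton)
  have restrict_median: "median_on (nb y) (\<lambda>z\<in>?V. \<eta> 0 z \<omega>) = median_on (nb y) (\<lambda>z. \<eta> 0 z \<omega>)"
    if "y \<in> ?V" for y \<omega>
    using nb(2)[OF that] by (intro median_on_cong) auto
  define late where "late = {\<omega> \<in> space M. t < W x 0 \<omega> \<and> \<eta> 0 x \<omega> \<le> a}"
  define clock where "clock y = {\<omega> \<in> space M. W x 0 \<omega> \<le> t \<and> first y \<omega>}" for y
  define early where "early y = {\<omega> \<in> space M. (W x 0 \<omega> \<le> t \<and> first y \<omega>) \<and>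
      median_on (nb y) (\<lambda>z. \<eta> 0 z \<omega>) \<le> a}" for y
  have med_sets: "{\<omega> \<in> space M. median_on (nb y) (\<lambda>z. \<eta> 0 z \<omega>) \<le> a} \<in> events" if y: "y \<in> ?V" for y
  proof -
    have "(\<lambda>\<omega>. \<lambda>z\<in>?V. \<eta> 0 z \<omega>) \<in> measurable M (PiM ?V (\<lambda>_. borel))"
      by (rule measurable_restrict) measurable
    moreover have "Measurable.pred (PiM ?V (\<lambda>_. borel)) (\<lambda>f. median_on (nb y) f \<le> a)"
      using nb[OF y] by (intro pred_median_on_le) auto
    ultimately have "Measurable.pred M (\<lambda>\<omega>. median_on (nb y) (\<lambda>z\<in>?V. \<eta> 0 z \<omega>) \<le> a)"
      by (rule measurable_compose)
    then show ?thesis by (simp add: pred_def restrict_median[OF y])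
  qed
  have clock_sets [measurable]: "clock y \<in> events" if "y \<in> ?V" for y
    unfolding clock_def first_def using that x by measurable
  have late_sets [measurable]: "late \<in> events"
    unfolding late_def using x by measurable
  have early_eq: "early y = clock y \<inter> {\<omega> \<in> space M. median_on (nb y) (\<lambda>z. \<eta> 0 z \<omega>) \<le> a}" for y
    by (auto simp: early_def clock_def)
  have early_sets: "early y \<in> events" if "y \<in> ?V" for y
    unfolding early_eq using that clock_sets med_sets by blast
  have disj: "disjoint_family_on clock ?V"
  unfolding disjoint_family_on_def proof (intro ballI impI)
    fix y z assume "y \<in> ?V" "z \<in> ?V" "y \<noteq> z"
    then show "clock y \<inter> clock z = {}"
      unfolding clock_def first_def using less_asym by blast
  qed
  then have disj_early: "disjoint_family_on early ?V"
    by (rule disjoint_family_on_bisimulation) (auto simp: early_eq)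

  have prob_late: "prob {\<omega> \<in> space M. t < W x 0 \<omega>} = exp (- t)"
    using exponential_distributedD_gt[OF waiting_exponential[OF x, of 0] t] by simp
  have "prob late = prob {\<omega> \<in> space M. \<eta> 0 x \<omega> \<le> a} * prob {\<omega> \<in> space M. t < W x 0 \<omega>}"
    using prob_initial_and_first_ring[of "\<lambda>f. f x \<le> a" "\<lambda>f. t < f x"] x
    by (simp add: late_def conj_commute)
  then have late: "prob late = exp (- t) * a"
    using prob_late prob_initial_le[OF x a] by simp

  have early: "prob (early y) = majority_prob k a * prob (clock y)" if y: "y \<in> ?V" for y
  proof -
    have "prob (early y) = prob {\<omega> \<in> space M. median_on (nb y) (\<lambda>z\<in>?V. \<eta> 0 z \<omega>) \<le> a \<and>
        (\<lambda>z\<in>?V. W z 0 \<omega>) x \<le> t \<and> (\<forall>z\<in>?V - {y}. (\<lambda>z\<in>?V. W z 0 \<omega>) y < (\<lambda>z\<in>?V. W z 0 \<omega>) z)}"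
      using x y unfolding early_def first_def restrict_median[OF y]
      by (intro arg_cong[where f=prob]) auto
    also have "\<dots> = prob {\<omega> \<in> space M. median_on (nb y) (\<lambda>z\<in>?V. \<eta> 0 z \<omega>) \<le> a} *
        prob {\<omega> \<in> space M. (\<lambda>z\<in>?V. W z 0 \<omega>) x \<le> t \<and>
          (\<forall>z\<in>?V - {y}. (\<lambda>z\<in>?V. W z 0 \<omega>) y < (\<lambda>z\<in>?V. W z 0 \<omega>) z)}"
    proof (rule prob_initial_and_first_ring)
      show "Measurable.pred (PiM ?V (\<lambda>_. borel)) (\<lambda>f. median_on (nb y) f \<le> a)"
        using nb[OF y] by (intro pred_median_on_le) auto
      show "Measurable.pred (PiM ?V (\<lambda>_. borel)) (\<lambda>f. f x \<le> t \<and> (\<forall>z\<in>?V - {y}. f y < f z))"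
        using x y by measurable
    qed
    also have "{\<omega> \<in> space M. (\<lambda>z\<in>?V. W z 0 \<omega>) x \<le> t \<and>
          (\<forall>z\<in>?V - {y}. (\<lambda>z\<in>?V. W z 0 \<omega>) y < (\<lambda>z\<in>?V. W z 0 \<omega>) z)} = clock y"
      using x y unfolding clock_def first_def by auto
    also have "prob {\<omega> \<in> space M. median_on (nb y) (\<lambda>z\<in>?V. \<eta> 0 z \<omega>) \<le> a} = majority_prob k a"
      unfolding restrict_median[OF y] using nb[OF y] a
      by (intro prob_median_le indep_vars_subset[OF initial_indep]) (auto intro!: prob_initial_le)
    finally show ?thesis .
  qed

  have "(\<Sum>y\<in>?V. prob (clock y)) = prob (\<Union>y\<in>?V. clock y)"
    using disj clock_sets by (intro finite_measure_finite_Union[symmetric]) auto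
  also have "\<dots> = prob (space M - {\<omega> \<in> space M. t < W x 0 \<omega>})"
  proof (rule measure_eq_AE)
    show "AE \<omega> in M. \<omega> \<in> (\<Union>y\<in>?V. clock y) \<longleftrightarrow> \<omega> \<in> space M - {\<omega> \<in> space M. t < W x 0 \<omega>}"
      using AE_ex_first_ring[OF x] AE_space
      by eventually_elim (auto simp: clock_def first_def)
    show "(\<Union>y\<in>?V. clock y) \<in> events" using clock_sets by (intro sets.finite_UN) auto
    show "space M - {\<omega> \<in> space M. t < W x 0 \<omega>} \<in> events" using x by measurable
  qed
  also have "\<dots> = 1 - exp (- t)"
    using x prob_late by (subst prob_compl) auto
  finally have sum_clock: "(\<Sum>y\<in>?V. prob (clock y)) = 1 - exp (- t)" .

  have "prob {\<omega> \<in> space M. \<eta> t x \<omega> \<le> a} = prob (late \<union> (\<Union>y\<in>?V. early y))"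
  proof (rule measure_eq_AE)
    show "AE \<omega> in M. \<omega> \<in> {\<omega> \<in> space M. \<eta> t x \<omega> \<le> a} \<longleftrightarrow> \<omega> \<in> late \<union> (\<Union>y\<in>?V. early y)"
      using AE_path_complete[OF K t x] AE_ex_first_ring[OF x] AE_space
    proof eventually_elim
      case (elim \<omega>)
      then obtain y where y: "y \<in> ?V" "first y \<omega>" by (auto simp: first_def)
      have \<eta>: "\<eta> t x \<omega> = (if t < W x 0 \<omega> then \<eta> 0 x \<omega> else median_on (nb z) (\<lambda>z. \<eta> 0 z \<omega>))"
        if "z \<in> ?V" "first z \<omega>" for z
        using elim(1) that by (auto simp: first_def nb_def)
      show ?case
      proof (cases "t < W x 0 \<omega>")
        case True
        then show ?thesis using \<eta>[OF y] elim(3) by (auto simp: late_def early_def)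
      next
        case False
        then have "\<omega> \<in> early z \<longleftrightarrow> first z \<omega> \<and> \<eta> t x \<omega> \<le> a" if "z \<in> ?V" for z
          using \<eta>[OF that] elim(3) by (auto simp: early_def)
        then show ?thesis using False y elim(3) by (auto simp: late_def)
      qed
    qed
    show "late \<union> (\<Union>y\<in>?V. early y) \<in> events"
      using late_sets early_sets by (intro sets.Un sets.finite_UN) auto
  qed measurable
  also have "\<dots> = prob late + prob (\<Union>y\<in>?V. early y)"
  proof (rule finite_measure_Union)
    show "(\<Union>y\<in>?V. early y) \<in> events" using early_sets by (intro sets.finite_UN) auto
    show "late \<inter> (\<Union>y\<in>?V. early y) = {}" by (auto simp: late_def early_def)
  qed (rule late_sets)
  also have "prob (\<Union>y\<in>?V. early y) = (\<Sum>y\<in>?V. prob (early y))"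
    using disj_early early_sets by (intro finite_measure_finite_Union) auto
  also have "\<dots> = majority_prob k a * (1 - exp (- t))"
    using early by (simp add: sum_clock flip: sum_distrib_left)
  finally show ?thesis
    using late by (simp add: k_def mult.commute)
qed



section \<open>Densities on the unit interval\<close>

text \<open>
  A distribution function on \<open>[0, 1]\<close> with a non-negative derivative determines the law. The density
  is first obtained on the whole line, extended by \<open>0\<close>, where half-lines generate the Borel sets.
\<close>

lemma (in prob_space) distributed_on_unit_intervalI:
  fixes X :: "'a \<Rightarrow> real"
  assumes X: "X \<in> measurable M (restrict_space borel {0..1})"
    and p: "p \<in> borel_measurable borel" "\<And>u. u \<in> {0..1} \<Longrightarrow> 0 \<le> p u"
    and F: "\<And>u. u \<in> {0..1} \<Longrightarrow> (F has_real_derivative p u) (at u)" "F 0 = 0" "F 1 = 1"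
    and cdf: "\<And>a. a \<in> {0..1} \<Longrightarrow> prob {\<omega> \<in> space M. X \<omega> \<le> a} = F a"
  shows "distributed M (restrict_space lborel {0..1}) X (\<lambda>u. ennreal (p u))"
proof -
  have X_borel [measurable]: "X \<in> borel_measurable M"
    using X measurable_restrict_space2_iff by blast
  have X_range: "X \<omega> \<in> {0..1}" if "\<omega> \<in> space M" for \<omega>
    using measurable_space[OF X that] by (simp add: space_restrict_space)
  note [measurable] = p(1)
  let ?f = "\<lambda>u. indicator {0..1} u * p u"
  define g where "g a = (if a < 0 then 0 else if a \<le> 1 then F a else 1)" for a
  have "distributed M lborel X (\<lambda>u. ennreal (?f u))"
  proof (rule distributedI_borel_atMost[where g=g])
    fix a :: real
    have FTC: "(\<integral>\<^sup>+u. ennreal (p u) * indicator {0..b} u \<partial>lborel) = F b" if "b \<in> {0..1}" for b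
      using nn_integral_FTC_Icc[of p 0 b F] p F that by simp
    have "(\<integral>\<^sup>+u. ennreal (?f u * indicator {..a} u) \<partial>lborel) =
        (\<integral>\<^sup>+u. ennreal (p u) * indicator {0..min a 1} u \<partial>lborel)"
      by (intro nn_integral_cong) (auto split: split_indicator)
    also have "\<dots> = ennreal (g a)"
      using FTC[of "min a 1"] F(3) by (cases "a < 0") (auto simp: g_def)
    finally show "(\<integral>\<^sup>+u. ennreal (?f u * indicator {..a} u) \<partial>lborel) = ennreal (g a)" .
    have "prob {\<omega> \<in> space M. X \<omega> \<le> a} = g a"
    proof -
      consider "a < 0" | "a \<in> {0..1}" | "1 < a" by fastforce
      then show ?thesis
      proof cases
        case 1
        then have empty: "{\<omega> \<in> space M. X \<omega> \<le> a} = {}" using X_range by force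
        show ?thesis unfolding empty using 1 by (simp add: g_def)
      next
        case 2
        then show ?thesis using cdf by (simp add: g_def)
      next
        case 3
        then have full: "{\<omega> \<in> space M. X \<omega> \<le> a} = space M" using X_range by force
        show ?thesis unfolding full using 3 F(3) by (simp add: g_def prob_space)
      qed
    qed
    then show "emeasure M {\<omega> \<in> space M. X \<omega> \<le> a} = ennreal (g a)"
      by (simp add: emeasure_eq_measure)
  qed (use p in \<open>auto simp: indicator_def\<close>)
  then have lborel: "emeasure M (X -` A \<inter> space M) = (\<integral>\<^sup>+u. ennreal (?f u) * indicator A u \<partial>lborel)"
    if "A \<in> sets borel" for A
    using that by (intro distributed_emeasure) auto
  let ?L = "restrict_space lborel {0..1 :: real}"
  have X_L: "X \<in> measurable M ?L"
    using X by (simp cong: measurable_cong_sets add: sets_restrict_space measurable_restrict_space2_iff)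
  show ?thesis
    unfolding distributed_def
  proof (intro conjI)
    show p_L: "(\<lambda>u. ennreal (p u)) \<in> borel_measurable ?L"
      by (rule measurable_restrict_space1) simp
    show "distr M ?L X = density ?L (\<lambda>u. ennreal (p u))"
    proof (rule measure_eqI)
      fix A assume "A \<in> sets (distr M ?L X)"
      then have A: "A \<in> sets ?L" by simp
      then have A': "A \<in> sets borel" "A \<subseteq> {0..1}"
        by (auto simp: sets_restrict_space_iff)
      have "emeasure (distr M ?L X) A = emeasure M (X -` A \<inter> space M)"
        using X_L A by (rule emeasure_distr)
      also have "\<dots> = (\<integral>\<^sup>+u. ennreal (p u) * indicator A u * indicator {0..1} u \<partial>lborel)"
        unfolding lborel[OF A'(1)] by (intro nn_integral_cong) (auto split: split_indicator)
      also have "\<dots> = (\<integral>\<^sup>+u. ennreal (p u) * indicator A u \<partial>?L)"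
        by (subst nn_integral_restrict_space) auto
      also have "\<dots> = emeasure (density ?L (\<lambda>u. ennreal (p u))) A"
        using p_L A by (rule emeasure_density[symmetric])
      finally show "emeasure (distr M ?L X) A = emeasure (density ?L (\<lambda>u. ennreal (p u))) A" .
    qed simp
  qed (rule X_L)
qed

text \<open>
  A law with a density has no atom at \<open>a\<close>, which reconciles the half-open interval with the
  distribution function.
\<close>

lemma (in prob_space) distributed_unit_interval_less_eq_le:
  fixes X :: "'a \<Rightarrow> real"
  assumes X: "distributed M (restrict_space lborel {0..1}) X f"
  shows "prob {\<omega> \<in> space M. X \<omega> \<in> {0..<a}} = prob {\<omega> \<in> space M. X \<omega> \<le> a}"
proof -
  let ?L = "restrict_space lborel {0..1 :: real}"
  have X_L: "X \<in> measurable M ?L" and f: "f \<in> borel_measurable ?L"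
    using X by (auto simp: distributed_def)
  have X_range: "X \<omega> \<in> {0..1}" if "\<omega> \<in> space M" for \<omega>
    using measurable_space[OF X_L that] by (simp add: space_restrict_space)
  have [measurable]: "X \<in> borel_measurable M"
    using X_L by (simp cong: measurable_cong_sets add: measurable_restrict_space2_iff)
  have "AE u in ?L. u \<noteq> a"
    using AE_lborel_singleton[of a] by (subst AE_restrict_space_iff) (auto elim: eventually_mono)
  then have "AE u in density ?L f. u \<noteq> a"
    using f by (subst AE_density) (auto elim: eventually_mono)
  then have "AE u in distr M ?L X. u \<noteq> a"
    by (simp only: distributed_distr_eq_density[OF X])
  then have "AE \<omega> in M. X \<omega> \<noteq> a"
    using X_L by (subst (asm) AE_distr_iff) (auto simp: sets_restrict_space_iff space_restrict_space
        intro: sets.sets_into_space)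
  then have ae: "AE \<omega> in M. \<omega> \<in> {\<omega> \<in> space M. X \<omega> \<in> {0..<a}} \<longleftrightarrow> \<omega> \<in> {\<omega> \<in> space M. X \<omega> \<le> a}"
    using AE_space
  proof eventually_elim
    case (elim \<omega>)
    then show ?case using X_range[of \<omega>] by auto
  qed
  show ?thesis by (rule measure_eq_AE[OF ae]) measurable
qed



section \<open>Monotonicity in time and shape of the density\<close>

theorem proposition3p10:
  fixes N :: nat
    and M :: "'w measure"
    and G :: "('v, 'e) pre_digraph"
    and \<eta> :: "real \<Rightarrow> 'v \<Rightarrow> 'w \<Rightarrow> real"
    and W :: "'v \<Rightarrow> nat \<Rightarrow> 'w \<Rightarrow> real"
    and x :: 'v
  assumes "N \<ge> 1"
    and "K\<^bsub>N\<^esub> G"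
    and "median_dynamics M G \<eta> W"
    and "x \<in> verts G"
  shows "(\<forall>\<alpha>\<in>{0..1/2}.
            antimono_on {0..} (\<lambda>t. measure M {\<omega> \<in> space M. \<eta> t x \<omega> \<in> {0..<\<alpha>}}))
       \<and> (\<forall>t\<ge>0. \<exists>p :: real \<Rightarrow> real.
            (\<forall>u\<in>{0..1}. 0 \<le> p u)
          \<and> distributed M (restrict_space lborel {0..1}) (\<eta> t x) (\<lambda>u. ennreal (p u))
          \<and> (\<forall>u\<in>{0..1}. p u = p (1 - u))
          \<and> mono_on {0..1/2} p)"
proof -
  interpret median_dynamics M G \<eta> W by fact
  define k where "k = (card (verts G) - 1) div 2"
  define p where "p t u = exp (- t) + (1 - exp (- t)) * majority_density k u" for t u :: real
  define F where "F t a = exp (- t) * a + (1 - exp (- t)) * majority_prob k a" for t a :: real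
  have p_nonneg: "0 \<le> p t u" if "0 \<le> t" "u \<in> {0..1}" for t u
    using that by (simp add: p_def majority_density_nonneg)
  have p_sym: "p t u = p t (1 - u)" for t u
    by (simp add: p_def majority_density_symmetric)
  have p_mono: "mono_on {0..1/2} (p t)" if "0 \<le> t" for t
    using that by (auto simp: p_def intro!: mono_onI mult_left_mono majority_density_mono)
  have cdf: "prob {\<omega> \<in> space M. \<eta> t x \<omega> \<le> a} = F t a" if "0 \<le> t" "a \<in> {0..1}" for t a
    using prob_le_complete[OF assms(2) that(1) assms(4)] that(2) by (simp add: F_def k_def)
  have dist: "distributed M (restrict_space lborel {0..1}) (\<eta> t x) (\<lambda>u. ennreal (p t u))"
    if t: "0 \<le> t" for t
  proof (rule distributed_on_unit_intervalI[where F="F t"])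
    show "\<eta> t x \<in> measurable M (restrict_space borel {0..1})"
      using t assms(4) by (rule state)
    show "p t \<in> borel_measurable borel"
      unfolding p_def majority_density_def by measurable
    show "(F t has_real_derivative p t u) (at u)" for u
      unfolding F_def p_def by (auto intro!: derivative_eq_intros DERIV_majority_prob)
  qed (use t in \<open>auto simp: cdf p_nonneg F_def majority_prob_0 majority_prob_1\<close>)
  have "antimono_on {0..} (\<lambda>t. measure M {\<omega> \<in> space M. \<eta> t x \<omega> \<in> {0..<\<alpha>}})"
    if \<alpha>: "\<alpha> \<in> {0..1/2}" for \<alpha>
  proof (rule monotone_onI)
    fix s t :: real
    assume st: "s \<in> {0..}" "t \<in> {0..}" "s \<le> t"
    have eq: "prob {\<omega> \<in> space M. \<eta> r x \<omega> \<in> {0..<\<alpha>}} = F r \<alpha>" if "0 \<le> r" for r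
      using distributed_unit_interval_less_eq_le[OF dist[OF that], of \<alpha>] cdf[OF that] \<alpha> by simp
    \<comment> \<open>The distribution function at \<open>\<alpha>\<close> is \<open>h(\<alpha>) + exp (-t) (\<alpha> - h(\<alpha>))\<close>.\<close>
    have "exp (- t) * (\<alpha> - majority_prob k \<alpha>) \<le> exp (- s) * (\<alpha> - majority_prob k \<alpha>)"
      using st \<alpha> majority_prob_le[of \<alpha> k] by (intro mult_right_mono) auto
    then have "F t \<alpha> \<le> F s \<alpha>" by (simp add: F_def algebra_simps)
    then show "prob {\<omega> \<in> space M. \<eta> s x \<omega> \<in> {0..<\<alpha>}} \<ge> prob {\<omega> \<in> space M. \<eta> t x \<omega> \<in> {0..<\<alpha>}}"
      using eq[of s] eq[of t] st by (simp only: atLeast_iff)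
  qed
  then show ?thesis
    using p_nonneg dist p_sym p_mono by blast
qed

end
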